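(* Let $X$ be an almost isometric ideal in a Banach space $Y$. If $Y$ has the local diameter 2 property, then so does $X$.
   Context: All Banach spaces are real. For a Banach space $Z$ with closed unit ball $B_Z$, a slice of $B_Z$ is a set $S(z^{*},\varepsilon)=\{z\in B_Z: z^{*}(z)>1-\varepsilon\}$, where $z^{*}\in Z^{*}$, $\|z^{*}\|=1$ and $\varepsilon>0$. $Z$ has the local diameter 2 property if every slice of $B_Z$ has diameter 2. (In the claim $X$ is itself regarded as a Banach space.) A subspace $X$ of a Banach space $Y$ is an almost isometric ideal (ai-ideal) in $Y$ if for every $\varepsilon>0$ and every finite-dimensional subspace $E\subset Y$ there exists a linear operator $T:E\to X$ such that $Te=e$ for all $e\in X\cap E$ and $(1+\varepsilon)^{-1}\|e\|\le\|Te\|\le(1+\varepsilon)\|e\|$ for all $e\in E$. *)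

theory Defs
  imports "HOL-Analysis.Analysis"
begin

text \<open>
  Subspaces are represented as sets in an ambient real normed space; the whole space is
  \<open>UNIV\<close>. Functionals and operators defined only on a subspace \<open>S\<close> are total HOL functions whose
  values outside \<open>S\<close> play no role.
\<close>

definition linear_on_subspace ::
    "'a::real_vector set \<Rightarrow> ('a \<Rightarrow> 'b::real_vector) \<Rightarrow> bool" where
  "linear_on_subspace S f \<longleftrightarrow>
     (\<forall>x\<in>S. \<forall>y\<in>S. f (x + y) = f x + f y) \<and> (\<forall>c. \<forall>x\<in>S. f (c *\<^sub>R x) = c *\<^sub>R f x)"

definition dual_space_on :: "'a::real_normed_vector set \<Rightarrow> ('a \<Rightarrow> real) set" where
  "dual_space_on Z =
     {f. linear_on_subspace Z f \<and> (\<exists>K. \<forall>z\<in>Z. \<bar>f z\<bar> \<le> K * norm z)}"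

definition dual_norm_on :: "'a::real_normed_vector set \<Rightarrow> ('a \<Rightarrow> real) \<Rightarrow> real" where
  "dual_norm_on Z f = (SUP z\<in>Z \<inter> cball 0 1. \<bar>f z\<bar>)"

definition slice_on :: "'a::real_normed_vector set \<Rightarrow> ('a \<Rightarrow> real) \<Rightarrow> real \<Rightarrow> 'a set" where
  "slice_on Z f \<epsilon> = {z \<in> Z \<inter> cball 0 1. f z > 1 - \<epsilon>}"

definition local_diameter_2_property :: "'a::real_normed_vector set \<Rightarrow> bool" where
  "local_diameter_2_property Z \<longleftrightarrow>
     (\<forall>f\<in>dual_space_on Z. \<forall>\<epsilon>>0. dual_norm_on Z f = 1 \<longrightarrow> diameter (slice_on Z f \<epsilon>) = 2)"

definition finite_dim_subspace :: "'a::real_vector set \<Rightarrow> bool" where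
  "finite_dim_subspace E \<longleftrightarrow> (\<exists>B. finite B \<and> E = span B)"

text \<open>An ai-ideal in \<open>UNIV\<close>: the ambient Banach space is the whole type.\<close>

definition almost_isometric_ideal :: "'a::real_normed_vector set \<Rightarrow> bool" where
  "almost_isometric_ideal X \<longleftrightarrow> subspace X \<and>
     (\<forall>\<epsilon>>0. \<forall>E. finite_dim_subspace E \<longrightarrow>
        (\<exists>T. linear_on_subspace E T \<and> T ` E \<subseteq> X \<and>
             (\<forall>e\<in>X \<inter> E. T e = e) \<and>
             (\<forall>e\<in>E. inverse (1 + \<epsilon>) * norm e \<le> norm (T e) \<and>
                    norm (T e) \<le> (1 + \<epsilon>) * norm e)))"

text \<open>On the whole space these notions are the library's bounded linear functionals and
  their operator norm.\<close>

lemma dual_space_on_UNIV: "f \<in> dual_space_on UNIV \<longleftrightarrow> bounded_linear f"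
proof
  assume "f \<in> dual_space_on UNIV"
  then obtain K where l: "linear_on_subspace UNIV f" and K: "\<And>z. \<bar>f z\<bar> \<le> K * norm z"
    by (auto simp: dual_space_on_def)
  show "bounded_linear f"
    by (rule bounded_linear_intro[where K = K])
      (use l K in \<open>auto simp: linear_on_subspace_def mult.commute\<close>)
next
  assume "bounded_linear f"
  then interpret bounded_linear f .
  obtain K where "\<And>z. norm (f z) \<le> norm z * K" using bounded by blast
  then show "f \<in> dual_space_on UNIV"
    by (auto simp: dual_space_on_def linear_on_subspace_def add scaleR mult.commute intro!: exI[of _ K])
qed

lemma dual_norm_on_UNIV:
  assumes "bounded_linear f"
  shows "dual_norm_on UNIV f = onorm f"
proof (rule antisym)
  interpret bounded_linear f by fact
  have bd: "\<bar>f z\<bar> \<le> onorm f" if "norm z \<le> 1" for z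
  proof -
    have "\<bar>f z\<bar> \<le> onorm f * norm z" using onorm[OF assms, of z] by simp
    also have "\<dots> \<le> onorm f" using that onorm_pos_le[OF assms] by (simp add: mult_left_le)
    finally show ?thesis .
  qed
  show "dual_norm_on UNIV f \<le> onorm f"
    unfolding dual_norm_on_def by (rule cSUP_least) (auto intro: bd simp: ex_in_conv[symmetric] intro!: exI[of _ 0])
  have bdd: "bdd_above ((\<lambda>z. \<bar>f z\<bar>) ` (UNIV \<inter> cball 0 1))"
    by (rule bdd_aboveI2[where M = "onorm f"]) (auto intro: bd)
  show "onorm f \<le> dual_norm_on UNIV f"
    unfolding onorm_def
  proof (rule cSUP_least)
    fix x
    have "norm (f x) / norm x = \<bar>f (x /\<^sub>R norm x)\<bar>" by (simp add: scaleR abs_mult divide_inverse)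
    also have "\<dots> \<le> dual_norm_on UNIV f"
      unfolding dual_norm_on_def by (rule cSUP_upper[OF _ bdd]) (cases "x = 0"; simp)
    finally show "norm (f x) / norm x \<le> dual_norm_on UNIV f" .
  qed simp
qed

end

theory Submission
  imports Defs
begin

text \<open>
  Let \<open>f\<close> be a functional of norm one on \<open>X\<close>. The almost isometric operators \<open>T\<close> pull \<open>f\<close> back to
  functionals \<open>f \<circ> T\<close> on finite-dimensional subspaces of the big space, of norm at most \<open>1 + \<epsilon>\<close> and
  agreeing with \<open>f\<close> on \<open>X\<close>. Organise these operators in a filter, directed by larger
  finite-dimensional subspaces and smaller \<open>\<epsilon>\<close> (lemma \<open>ai_ideal_operator_filter\<close>). By Tychonoff's
  theorem the functions \<open>f \<circ> T\<close> have a pointwise cluster point \<open>g\<close>, which is a functional of norm one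
  on the whole space (lemma \<open>ai_ideal_extension\<close>).

  The point of constructing \<open>g\<close> in this way, rather than taking an arbitrary Hahn--Banach extension
  of \<open>f\<close>, is that inequalities \<open>g y > \<alpha>\<close> at finitely many points are inherited by \<open>f (T y) > \<alpha>\<close> for
  some almost isometric \<open>T\<close>. So take two points \<open>y\<close>, \<open>z\<close> of a slice defined by \<open>g\<close> at distance
  almost 2. Such a \<open>T\<close> carries them into \<open>X\<close>, and after division by \<open>1 + \<epsilon>\<close>, which brings them back
  into the unit ball, they lie in the given slice defined by \<open>f\<close> and are still almost 2 apart.
\<close>

section \<open>Functionals of norm one\<close>

lemma dual_space_on_bdd_above:
  assumes "f \<in> dual_space_on Z"
  shows "bdd_above ((\<lambda>z. \<bar>f z\<bar>) ` (Z \<inter> cball 0 1))"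
proof -
  obtain K where K: "\<And>z. z \<in> Z \<Longrightarrow> \<bar>f z\<bar> \<le> K * norm z"
    using assms by (auto simp: dual_space_on_def)
  show ?thesis
  proof (rule bdd_aboveI2[where M = "\<bar>K\<bar>"])
    fix z assume z: "z \<in> Z \<inter> cball 0 1"
    have "\<bar>f z\<bar> \<le> K * norm z" using K z by auto
    also have "\<dots> \<le> \<bar>K\<bar> * norm z" by (simp add: mult_right_mono)
    also have "\<dots> \<le> \<bar>K\<bar>" using z by (simp add: mult_left_le)
    finally show "\<bar>f z\<bar> \<le> \<bar>K\<bar>" .
  qed
qed

lemma abs_le_dual_norm_on:
  assumes "subspace Z" "f \<in> dual_space_on Z" "z \<in> Z"
  shows "\<bar>f z\<bar> \<le> dual_norm_on Z f * norm z"
proof (cases "z = 0")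
  case True
  have "f (0 *\<^sub>R z) = 0 *\<^sub>R f z"
    using assms(2,3) unfolding dual_space_on_def linear_on_subspace_def by blast
  then show ?thesis using True by simp
next
  case False
  have "\<bar>f (inverse (norm z) *\<^sub>R z)\<bar> \<le> dual_norm_on Z f"
    unfolding dual_norm_on_def using assms(1,3) False
    by (intro cSUP_upper[OF _ dual_space_on_bdd_above[OF assms(2)]])
       (simp add: subspace_scale)
  moreover have "f (inverse (norm z) *\<^sub>R z) = inverse (norm z) * f z"
    using assms(2,3) by (auto simp: dual_space_on_def linear_on_subspace_def)
  ultimately have "inverse (norm z) * \<bar>f z\<bar> \<le> dual_norm_on Z f"
    by (simp add: abs_mult)
  then show ?thesis
    using False by (simp add: field_simps)
qed

lemma diameter_slice_on_le: "diameter (slice_on Z f \<epsilon>) \<le> 2"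
proof (rule diameter_le)
  fix x y assume "x \<in> slice_on Z f \<epsilon>" "y \<in> slice_on Z f \<epsilon>"
  then show "norm (x - y) \<le> 2"
    using norm_triangle_ineq4[of x y] by (auto simp: slice_on_def)
qed simp

lemma bounded_slice_on: "bounded (slice_on Z f \<epsilon>)"
  by (rule bounded_subset[OF bounded_cball[of 0 1]]) (auto simp: slice_on_def)

section \<open>The filter of almost isometric operators\<close>

text \<open>
  The filter is generated by the sets of operators that work for the span of a finite set \<open>F\<close> and a
  given \<open>\<eta>\<close>; since these sets shrink as \<open>F\<close> grows and \<open>\<eta>\<close> decreases, they form a filter base. The
  operators are extended by 0 outside that span, so that the bound \<open>2 * norm y\<close> holds everywhere and
  the functions \<open>f \<circ> T\<close> stay in one fixed compact product of intervals.
\<close>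

lemma ai_ideal_operator_filter:
  fixes X :: "'a::real_normed_vector set"
  assumes "almost_isometric_ideal X"
  obtains A :: "('a \<Rightarrow> 'a) filter" where
    "A \<noteq> bot"
    "\<forall>\<^sub>F T in A. \<forall>y. T y \<in> X \<and> norm (T y) \<le> 2 * norm y"
    "\<And>x y. \<forall>\<^sub>F T in A. T (x + y) = T x + T y"
    "\<And>c x. \<forall>\<^sub>F T in A. T (c *\<^sub>R x) = c *\<^sub>R T x"
    "\<And>x. x \<in> X \<Longrightarrow> \<forall>\<^sub>F T in A. T x = x"
    "\<And>\<eta> x. 0 < \<eta> \<Longrightarrow> \<forall>\<^sub>F T in A. inverse (1 + \<eta>) * norm x \<le> norm (T x) \<and> norm (T x) \<le> (1 + \<eta>) * norm x"
proof -
  define ops :: "'a set \<Rightarrow> real \<Rightarrow> ('a \<Rightarrow> 'a) set" where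
    "ops F \<eta> = {T. (\<forall>y. T y \<in> X \<and> norm (T y) \<le> 2 * norm y) \<and> linear_on_subspace (span F) T \<and>
       (\<forall>e\<in>X \<inter> span F. T e = e) \<and>
       (\<forall>e\<in>span F. inverse (1 + \<eta>) * norm e \<le> norm (T e) \<and> norm (T e) \<le> (1 + \<eta>) * norm e)}" for F \<eta>
  define I :: "('a set \<times> real) set" where "I = {F. finite F} \<times> {0<..}"
  define A where "A = (INF i\<in>I. principal (ops (fst i) (snd i)))"
  have X: "subspace X" using assms by (simp add: almost_isometric_ideal_def)
  have ops_mono: "ops F' \<eta>' \<subseteq> ops F \<eta>" if "F \<subseteq> F'" "0 < \<eta>'" "\<eta>' \<le> \<eta>" for F F' and \<eta> \<eta>' :: real
  proof
    fix T assume T: "T \<in> ops F' \<eta>'"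
    have sub: "span F \<subseteq> span F'" using that(1) by (rule span_mono)
    have "inverse (1 + \<eta>) * norm e \<le> norm (T e) \<and> norm (T e) \<le> (1 + \<eta>) * norm e"
      if e: "e \<in> span F" for e
    proof -
      have "inverse (1 + \<eta>) * norm e \<le> inverse (1 + \<eta>') * norm e"
        using \<open>0 < \<eta>'\<close> \<open>\<eta>' \<le> \<eta>\<close> by (intro mult_right_mono le_imp_inverse_le) auto
      moreover have "(1 + \<eta>') * norm e \<le> (1 + \<eta>) * norm e"
        using \<open>\<eta>' \<le> \<eta>\<close> by (intro mult_right_mono) auto
      moreover have "inverse (1 + \<eta>') * norm e \<le> norm (T e) \<and> norm (T e) \<le> (1 + \<eta>') * norm e"
        using T e sub by (auto simp: ops_def)
      ultimately show ?thesis by linarith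
    qed
    moreover have "linear_on_subspace (span F) T"
      using T sub unfolding ops_def linear_on_subspace_def by blast
    moreover have "\<forall>e\<in>X \<inter> span F. T e = e"
      using T sub unfolding ops_def by blast
    ultimately show "T \<in> ops F \<eta>"
      using T unfolding ops_def by blast
  qed
  have ops_nonempty: "ops F \<eta> \<noteq> {}" if "finite F" "0 < \<eta>" for F \<eta>
  proof -
    define \<theta> where "\<theta> = min \<eta> 1"
    have \<theta>: "0 < \<theta>" "\<theta> \<le> \<eta>" "\<theta> \<le> 1" using that by (auto simp: \<theta>_def)
    have "finite_dim_subspace (span F)"
      using that by (auto simp: finite_dim_subspace_def)
    then obtain T where T: "linear_on_subspace (span F) T" "T ` span F \<subseteq> X"
        "\<forall>e\<in>X \<inter> span F. T e = e"
        "\<forall>e\<in>span F. inverse (1 + \<theta>) * norm e \<le> norm (T e) \<and> norm (T e) \<le> (1 + \<theta>) * norm e"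
      using assms \<theta>(1) unfolding almost_isometric_ideal_def by meson
    define T' where "T' y = (if y \<in> span F then T y else 0)" for y
    have bound: "norm (T y) \<le> 2 * norm y" if "y \<in> span F" for y
    proof -
      have "norm (T y) \<le> (1 + \<theta>) * norm y" using T(4) that by blast
      also have "\<dots> \<le> 2 * norm y" using \<theta> by (intro mult_right_mono) auto
      finally show ?thesis .
    qed
    have "T' \<in> ops F \<theta>"
      using T bound subspace_0[OF X]
      by (auto simp: ops_def T'_def linear_on_subspace_def span_add span_scale)
    then show ?thesis using ops_mono[of F F \<theta> \<eta>] \<theta> by blast
  qed
  have ev_A: "eventually P A \<longleftrightarrow> (\<exists>F \<eta>. finite F \<and> 0 < \<eta> \<and> (\<forall>T\<in>ops F \<eta>. P T))" for P
  proof -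
    have directed: "\<exists>k\<in>I. principal (ops (fst k) (snd k)) \<le>
        inf (principal (ops (fst i) (snd i))) (principal (ops (fst j) (snd j)))"
      if ij: "i \<in> I" "j \<in> I" for i j
    proof -
      obtain F \<eta> F' \<eta>' where eq: "i = (F, \<eta>)" "j = (F', \<eta>')" by fastforce
      have "(F \<union> F', min \<eta> \<eta>') \<in> I" using ij eq by (auto simp: I_def)
      moreover have "ops (F \<union> F') (min \<eta> \<eta>') \<subseteq> ops F \<eta>" "ops (F \<union> F') (min \<eta> \<eta>') \<subseteq> ops F' \<eta>'"
        using ij eq by (simp_all add: I_def ops_mono)
      ultimately show ?thesis
        by (intro bexI[of _ "(F \<union> F', min \<eta> \<eta>')"]) (auto simp: eq)
    qed
    have "I \<noteq> {}" by (auto simp: I_def intro: exI[of _ "{}"] exI[of _ 1])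
    have "eventually P A \<longleftrightarrow> (\<exists>i\<in>I. eventually P (principal (ops (fst i) (snd i))))"
      unfolding A_def by (rule eventually_INF_base[OF \<open>I \<noteq> {}\<close>]) (rule directed)
    then show ?thesis
      by (auto simp: I_def eventually_principal)
  qed
  have ev: "eventually P A" if "finite F" "0 < \<eta>" "\<And>T. T \<in> ops F \<eta> \<Longrightarrow> P T" for P F \<eta>
    using that ev_A by blast
  show thesis
  proof
    show "A \<noteq> bot"
      using ops_nonempty unfolding trivial_limit_def ev_A by blast
    show "\<forall>\<^sub>F T in A. \<forall>y. T y \<in> X \<and> norm (T y) \<le> 2 * norm y"
      by (rule ev[of "{}" 1]) (auto simp: ops_def)
    show "\<forall>\<^sub>F T in A. T (x + y) = T x + T y" for x y
      by (rule ev[of "{x, y}" 1]) (auto simp: ops_def linear_on_subspace_def span_base)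
    show "\<forall>\<^sub>F T in A. T (c *\<^sub>R x) = c *\<^sub>R T x" for c x
      by (rule ev[of "{x}" 1]) (auto simp: ops_def linear_on_subspace_def span_base)
    show "\<forall>\<^sub>F T in A. T x = x" if "x \<in> X" for x
      using that by (intro ev[of "{x}" 1]) (auto simp: ops_def span_base)
    show "\<forall>\<^sub>F T in A. inverse (1 + \<eta>) * norm x \<le> norm (T x) \<and> norm (T x) \<le> (1 + \<eta>) * norm x"
      if "0 < \<eta>" for \<eta> x
      using that by (intro ev[of "{x}" \<eta>]) (auto simp: ops_def span_base)
  qed
qed

section \<open>Extending a functional along the filter\<close>

text \<open>
  This is the form in which compactness replaces the choice of an ultrafilter: a finer filter that
  converges is enough, because events that hold eventually for \<open>F\<close> persist on it.
\<close>

lemma compact_imp_convergent_subfilter: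
  assumes "compact K" "F \<noteq> bot" "\<forall>\<^sub>F x in F. h x \<in> K"
  obtains g G where "G \<le> F" "G \<noteq> bot" "(h \<longlongrightarrow> g) G"
proof -
  have "filtermap h F \<noteq> bot" "\<forall>\<^sub>F y in filtermap h F. y \<in> K"
    using assms(2,3) by (auto simp: filtermap_bot_iff eventually_filtermap)
  then obtain g where g: "inf (nhds g) (filtermap h F) \<noteq> bot"
    using assms(1) unfolding compact_filter by blast
  define G where "G = inf (filtercomap h (nhds g)) F"
  have "G \<noteq> bot"
  proof
    assume "G = bot"
    then have "eventually (\<lambda>_. False) G" by simp
    then obtain Q R where Q: "eventually Q (nhds g)" and R: "eventually R F"
        and QR: "\<And>x. Q (h x) \<Longrightarrow> R x \<Longrightarrow> False"
      unfolding G_def eventually_inf eventually_filtercomap by blast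
    have "eventually (\<lambda>y. \<not> Q y) (filtermap h F)"
      unfolding eventually_filtermap using R by (rule eventually_mono) (use QR in blast)
    with Q have "eventually (\<lambda>_. False) (inf (nhds g) (filtermap h F))"
      unfolding eventually_inf by blast
    with g show False by (simp add: trivial_limit_def)
  qed
  moreover have "(h \<longlongrightarrow> g) G"
    unfolding G_def filterlim_iff_le_filtercomap by simp
  moreover have "G \<le> F" by (simp add: G_def)
  ultimately show thesis using that by blast
qed

lemma compact_PiE_UNIV:
  fixes K :: "'i \<Rightarrow> 'b::topological_space set"
  assumes "\<And>i. compact (K i)"
  shows "compact (PiE UNIV K)"
proof -
  have "compactin (product_topology (\<lambda>_. euclidean) UNIV) (PiE UNIV K)"
    using assms by (simp add: compactin_PiE)
  then show ?thesis by (simp add: euclidean_product_topology)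
qed

text \<open>
  Linearity and the norm bound pass to the limit since each involves only finitely many points. In
  contrast to a mere norm-preserving extension, \<open>g\<close> is approximated by \<open>f \<circ> T\<close>, which is what the
  last statement records; it serves to bring slices of the big ball back to \<open>X\<close>.
\<close>

lemma ai_ideal_extension:
  fixes X :: "'a::real_normed_vector set"
  assumes ai: "almost_isometric_ideal X"
    and f: "f \<in> dual_space_on X" and norm_f: "dual_norm_on X f = 1"
  obtains g :: "'a \<Rightarrow> real" where "g \<in> dual_space_on UNIV" "dual_norm_on UNIV g = 1"
    "\<And>\<alpha> \<eta> y z. \<lbrakk>\<alpha> < g y; \<alpha> < g z; 0 < \<eta>\<rbrakk> \<Longrightarrow>
       \<exists>u\<in>X. \<exists>v\<in>X. \<alpha> < f u \<and> \<alpha> < f v \<and> norm u \<le> (1 + \<eta>) * norm y \<and> norm v \<le> (1 + \<eta>) * norm z \<and>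
         inverse (1 + \<eta>) * dist y z \<le> dist u v"
proof -
  have X: "subspace X" using ai by (simp add: almost_isometric_ideal_def)
  have f_le: "\<bar>f x\<bar> \<le> norm x" if "x \<in> X" for x
    using abs_le_dual_norm_on[OF X f that] norm_f by simp
  have f_add: "f (x + y) = f x + f y" if "x \<in> X" "y \<in> X" for x y
    using f that by (auto simp: dual_space_on_def linear_on_subspace_def)
  have f_scale: "f (c *\<^sub>R x) = c * f x" if "x \<in> X" for c x
    using f that by (auto simp: dual_space_on_def linear_on_subspace_def)
  obtain A :: "('a \<Rightarrow> 'a) filter" where A: "A \<noteq> bot"
    and A_X: "\<forall>\<^sub>F T in A. \<forall>y. T y \<in> X \<and> norm (T y) \<le> 2 * norm y"
    and A_add: "\<And>x y. \<forall>\<^sub>F T in A. T (x + y) = T x + T y"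
    and A_scale: "\<And>c x. \<forall>\<^sub>F T in A. T (c *\<^sub>R x) = c *\<^sub>R T x"
    and A_id: "\<And>x. x \<in> X \<Longrightarrow> \<forall>\<^sub>F T in A. T x = x"
    and A_iso: "\<And>\<eta> x. 0 < \<eta> \<Longrightarrow>
      \<forall>\<^sub>F T in A. inverse (1 + \<eta>) * norm x \<le> norm (T x) \<and> norm (T x) \<le> (1 + \<eta>) * norm x"
    using ai_ideal_operator_filter[OF ai] by blast
  have "compact (PiE UNIV (\<lambda>y::'a. cball (0::real) (2 * norm y)))"
    by (intro compact_PiE_UNIV compact_cball)
  moreover have "\<forall>\<^sub>F T in A. (\<lambda>y. f (T y)) \<in> PiE UNIV (\<lambda>y. cball 0 (2 * norm y))"
    using A_X
  proof (rule eventually_mono)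
    fix T :: "'a \<Rightarrow> 'a" assume T: "\<forall>y. T y \<in> X \<and> norm (T y) \<le> 2 * norm y"
    have "\<bar>f (T y)\<bar> \<le> 2 * norm y" for y
      using f_le[of "T y"] T by (meson order_trans)
    then show "(\<lambda>y. f (T y)) \<in> PiE UNIV (\<lambda>y. cball 0 (2 * norm y))" by auto
  qed
  ultimately obtain g G where G: "G \<le> A" "G \<noteq> bot" and lim: "((\<lambda>T y. f (T y)) \<longlongrightarrow> g) G"
    using compact_imp_convergent_subfilter[OF _ A] by metis
  have lim_at: "((\<lambda>T. f (T y)) \<longlongrightarrow> g y) G" for y
  proof -
    from continuous_on_tendsto_compose[OF continuous_on_product_coordinates[of y] lim]
    show ?thesis by simp
  qed
  have in_G: "eventually P G" if "eventually P A" for P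
    using that G(1) by (simp add: filter_leD)
  have G_X: "\<forall>\<^sub>F T in G. \<forall>y. T y \<in> X" using in_G[OF A_X] by (rule eventually_mono) blast
  have g_add: "g (x + y) = g x + g y" for x y
  proof (rule tendsto_unique[OF G(2) lim_at])
    have "\<forall>\<^sub>F T in G. f (T x) + f (T y) = f (T (x + y))"
      using G_X in_G[OF A_add[of x y]] by eventually_elim (simp add: f_add)
    with tendsto_add[OF lim_at lim_at] show "((\<lambda>T. f (T (x + y))) \<longlongrightarrow> g x + g y) G"
      by (rule Lim_transform_eventually)
  qed
  have g_scale: "g (c *\<^sub>R x) = c * g x" for c x
  proof (rule tendsto_unique[OF G(2) lim_at])
    have "\<forall>\<^sub>F T in G. c * f (T x) = f (T (c *\<^sub>R x))"
      using G_X in_G[OF A_scale[of c x]] by eventually_elim (simp add: f_scale)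
    with tendsto_mult_left[OF lim_at] show "((\<lambda>T. f (T (c *\<^sub>R x))) \<longlongrightarrow> c * g x) G"
      by (rule Lim_transform_eventually)
  qed
  have g_X: "g x = f x" if "x \<in> X" for x
  proof (rule tendsto_unique[OF G(2) lim_at])
    have "\<forall>\<^sub>F T in G. f x = f (T x)"
      using in_G[OF A_id[OF that]] by eventually_elim simp
    with tendsto_const show "((\<lambda>T. f (T x)) \<longlongrightarrow> f x) G"
      by (rule Lim_transform_eventually)
  qed
  have g_le: "\<bar>g y\<bar> \<le> norm y" for y
  proof -
    have "\<bar>g y\<bar> \<le> (1 + \<eta>) * norm y" if "0 < \<eta>" for \<eta>
    proof (rule tendsto_upperbound[OF tendsto_rabs[OF lim_at] _ G(2)])
      show "\<forall>\<^sub>F T in G. \<bar>f (T y)\<bar> \<le> (1 + \<eta>) * norm y"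
        using G_X in_G[OF A_iso[OF that, of y]]
        by eventually_elim (auto intro: order_trans[OF f_le])
    qed
    then have ev: "\<forall>\<^sub>F \<eta> in at_right 0. \<bar>g y\<bar> \<le> (1 + \<eta>) * norm y"
      by (rule eventually_mono[OF eventually_at_right_less])
    have "((\<lambda>\<eta>. (1 + \<eta>) * norm y) \<longlongrightarrow> (1 + 0) * norm y) (at_right 0)"
      by (intro tendsto_intros)
    from tendsto_lowerbound[OF this ev] show ?thesis by simp
  qed
  have g_dual: "g \<in> dual_space_on UNIV"
    using g_add g_scale g_le
    by (auto simp: dual_space_on_def linear_on_subspace_def intro!: exI[of _ 1])
  have "dual_norm_on UNIV g \<le> 1"
    unfolding dual_norm_on_def
    by (rule cSUP_least) (auto intro: order_trans[OF g_le] simp: ex_in_conv[symmetric] intro!: exI[of _ 0])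
  moreover have "dual_norm_on X f \<le> dual_norm_on UNIV g"
    unfolding dual_norm_on_def
    using subspace_0[OF X] g_X
    by (intro cSUP_mono dual_space_on_bdd_above[OF g_dual]) force+
  ultimately have "dual_norm_on UNIV g = 1" using norm_f by simp
  moreover have "\<exists>u\<in>X. \<exists>v\<in>X. \<alpha> < f u \<and> \<alpha> < f v \<and> norm u \<le> (1 + \<eta>) * norm y \<and>
      norm v \<le> (1 + \<eta>) * norm z \<and> inverse (1 + \<eta>) * dist y z \<le> dist u v"
    if "\<alpha> < g y" "\<alpha> < g z" "0 < \<eta>" for \<alpha> \<eta> y z
  proof -
    have "\<forall>\<^sub>F T in G. T y \<in> X \<and> T z \<in> X \<and> \<alpha> < f (T y) \<and> \<alpha> < f (T z) \<and>
        norm (T y) \<le> (1 + \<eta>) * norm y \<and> norm (T z) \<le> (1 + \<eta>) * norm z \<and>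
        inverse (1 + \<eta>) * dist y z \<le> dist (T y) (T z)"
      using G_X order_tendstoD(1)[OF lim_at that(1)] order_tendstoD(1)[OF lim_at that(2)]
        in_G[OF A_iso[OF that(3), of y]] in_G[OF A_iso[OF that(3), of z]]
        in_G[OF A_iso[OF that(3), of "y - z"]] in_G[OF A_add[of y "- z"]] in_G[OF A_scale[of "-1" z]]
    proof eventually_elim
      case (elim T)
      then have "T (y - z) = T y - T z" by simp
      with elim show ?case by (simp add: dist_norm)
    qed
    from eventually_happens'[OF G(2) this] show ?thesis by blast
  qed
  ultimately show thesis by (rule that[OF g_dual])
qed

section \<open>Inheritance of the local diameter 2 property\<close>

theorem corollary3p4:
  fixes X :: "'a::banach set"
  assumes "closed X"
    and "almost_isometric_ideal X"
    and "local_diameter_2_property (UNIV :: 'a set)"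
  shows "local_diameter_2_property X"
  unfolding local_diameter_2_property_def
proof (intro ballI allI impI)
  fix f \<epsilon> assume f: "f \<in> dual_space_on X" and \<epsilon>: "0 < (\<epsilon>::real)" and norm_f: "dual_norm_on X f = 1"
  have X: "subspace X" using assms(2) by (simp add: almost_isometric_ideal_def)
  obtain g :: "'a \<Rightarrow> real" where g: "g \<in> dual_space_on UNIV" "dual_norm_on UNIV g = 1"
    and approx: "\<And>\<alpha> \<eta> y z. \<lbrakk>\<alpha> < g y; \<alpha> < g z; 0 < \<eta>\<rbrakk> \<Longrightarrow>
       \<exists>u\<in>X. \<exists>v\<in>X. \<alpha> < f u \<and> \<alpha> < f v \<and> norm u \<le> (1 + \<eta>) * norm y \<and> norm v \<le> (1 + \<eta>) * norm z \<and>
         inverse (1 + \<eta>) * dist y z \<le> dist u v"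
    by (rule ai_ideal_extension[OF assms(2) f norm_f]) (rule that)
  let ?D = "diameter (slice_on X f \<epsilon>)"
  have key: "2 - \<eta> \<le> (1 + \<eta>) * (1 + \<eta>) * ?D" if \<eta>: "0 < \<eta>" "\<eta> < 1" "\<eta> < \<epsilon> / 2" for \<eta>
  proof -
    have "diameter (slice_on UNIV g (\<epsilon> / 2)) = 2"
      using assms(3) g half_gt_zero[OF \<epsilon>] unfolding local_diameter_2_property_def by blast
    then obtain y z where yz: "y \<in> slice_on UNIV g (\<epsilon> / 2)" "z \<in> slice_on UNIV g (\<epsilon> / 2)"
        and dist_yz: "2 - \<eta> < dist y z"
      using diameter_lower_bounded[OF bounded_slice_on[of UNIV g "\<epsilon> / 2"], of "2 - \<eta>"] \<eta> by auto
    then obtain u v where uv: "u \<in> X" "v \<in> X" "1 - \<epsilon> / 2 < f u" "1 - \<epsilon> / 2 < f v"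
        and "norm u \<le> (1 + \<eta>) * norm y" "norm v \<le> (1 + \<eta>) * norm z"
        and dist_uv: "inverse (1 + \<eta>) * dist y z \<le> dist u v"
      using approx[of "1 - \<epsilon> / 2" y z \<eta>] \<eta> by (auto simp: slice_on_def)
    moreover have "(1 + \<eta>) * norm y \<le> 1 + \<eta>" "(1 + \<eta>) * norm z \<le> 1 + \<eta>"
      using yz \<eta> by (auto simp: slice_on_def intro!: mult_left_le)
    ultimately have norms: "norm u \<le> 1 + \<eta>" "norm v \<le> 1 + \<eta>" by linarith+
    let ?c = "inverse (1 + \<eta>)"
    \<comment> \<open>Shrinking costs the factor \<open>1 + \<eta>\<close> in the value of \<open>f\<close>; the gap between \<open>\<epsilon> / 2\<close> and \<open>\<epsilon>\<close> pays for it.\<close>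
    have in_slice: "?c *\<^sub>R w \<in> slice_on X f \<epsilon>"
      if "w \<in> X" "norm w \<le> 1 + \<eta>" "1 - \<epsilon> / 2 < f w" for w
    proof -
      have "(1 - \<epsilon>) * (1 + \<eta>) \<le> 1 - \<epsilon> / 2"
        using \<eta>(3) mult_pos_pos[OF \<epsilon> \<eta>(1)] by (simp add: algebra_simps)
      then have "(1 - \<epsilon>) * (1 + \<eta>) < f w" using that by linarith
      then have "1 - \<epsilon> < ?c * f w" using \<eta> by (simp add: field_simps)
      moreover have "f (?c *\<^sub>R w) = ?c * f w"
        using f that by (auto simp: dual_space_on_def linear_on_subspace_def)
      ultimately have "1 - \<epsilon> < f (?c *\<^sub>R w)" by simp
      moreover have "norm (?c *\<^sub>R w) \<le> 1" using that(2) \<eta> by (simp add: field_simps)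
      moreover have "?c *\<^sub>R w \<in> X" using X that(1) by (rule subspace_scale)
      ultimately show ?thesis by (simp add: slice_on_def del: norm_scaleR)
    qed
    have "dist (?c *\<^sub>R u) (?c *\<^sub>R v) \<le> ?D"
      using uv norms by (intro diameter_bounded_bound bounded_slice_on in_slice)
    moreover have "dist (?c *\<^sub>R u) (?c *\<^sub>R v) = ?c * dist u v"
      using \<eta> by (simp add: dist_norm flip: scaleR_diff_right)
    ultimately have "?c * dist u v \<le> ?D" by simp
    then have "dist u v \<le> (1 + \<eta>) * ?D" using \<eta> by (simp add: field_simps)
    with dist_uv have "inverse (1 + \<eta>) * dist y z \<le> (1 + \<eta>) * ?D" by linarith
    then have "dist y z \<le> (1 + \<eta>) * ((1 + \<eta>) * ?D)" using \<eta> by (simp add: field_simps)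
    with dist_yz show ?thesis by (simp add: mult.assoc)
  qed
  have "2 - 0 \<le> (1 + 0) * (1 + 0) * ?D"
  proof (rule tendsto_le)
    show "\<forall>\<^sub>F \<eta> in at_right 0. 2 - \<eta> \<le> (1 + \<eta>) * (1 + \<eta>) * ?D"
      using eventually_at_right_real[of 0 "min 1 (\<epsilon> / 2)"] \<epsilon>
      by (auto elim!: eventually_mono intro!: key)
    show "((\<lambda>\<eta>. 2 - \<eta>) \<longlongrightarrow> 2 - 0) (at_right (0::real))"
      by (intro tendsto_intros)
    show "((\<lambda>\<eta>. (1 + \<eta>) * (1 + \<eta>) * ?D) \<longlongrightarrow> (1 + 0) * (1 + 0) * ?D) (at_right 0)"
      by (intro tendsto_intros)
  qed simp
  then show "?D = 2" using diameter_slice_on_le[of X f \<epsilon>] by simp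
qed

end
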